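(* For each positive integer $\Delta$, the set $\mathcal{M}_{\Delta}$ of $\Delta$-modular matroids contains no spike of rank greater than $2\Delta$.
   Context: For a positive integer $\Delta$, an integer matrix $\mathbf{A}$ is $\Delta$-modular if the determinant of each $\operatorname{rank}(\mathbf{A}) \times \operatorname{rank}(\mathbf{A})$ submatrix of $\mathbf{A}$ has absolute value at most $\Delta$. $\mathcal{M}_{\Delta}$ denotes the set of $\Delta$-modular matroids, i.e. the matroids that have a representation over $\mathbb{R}$ as a $\Delta$-modular (integer) matrix (the ground set indexes the columns, and the rank of a set of elements is the rank of the corresponding set of columns). A matroid is simple if it has no loops and no parallel pairs; the simplification of a matroid is obtained by deleting all loops and selecting one element from each parallel class. $M/t$ denotes contraction of $t$. A spike is a simple matroid $S$ with an element $t$, called the tip, such that the simplification of $S/t$ is a circuit and each parallel class of $S/t$ has size two. *)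

theory Defs
  imports
    Jordan_Normal_Form.DL_Rank
    Jordan_Normal_Form.DL_Submatrix
    Jordan_Normal_Form.Determinant
begin

section \<open>Finite matroids\<close>

record 'a matroid =
  ground :: "'a set"
  indep :: "'a set \<Rightarrow> bool"

definition is_matroid :: "'a matroid \<Rightarrow> bool" where
  "is_matroid M \<longleftrightarrow>
     finite (ground M) \<and>
     (\<forall>X. indep M X \<longrightarrow> X \<subseteq> ground M) \<and>
     indep M {} \<and>
     (\<forall>X Y. indep M Y \<and> X \<subseteq> Y \<longrightarrow> indep M X) \<and>
     (\<forall>X Y. indep M X \<and> indep M Y \<and> card X < card Y \<longrightarrow>
        (\<exists>y\<in>Y - X. indep M (insert y X)))"

definition rank_of :: "'a matroid \<Rightarrow> 'a set \<Rightarrow> nat" where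
  "rank_of M X = Max (card ` {I. I \<subseteq> X \<and> indep M I})"

abbreviation matroid_rank :: "'a matroid \<Rightarrow> nat" where
  "matroid_rank M \<equiv> rank_of M (ground M)"

definition basis_of :: "'a matroid \<Rightarrow> 'a set \<Rightarrow> 'a set \<Rightarrow> bool" where
  "basis_of M X B \<longleftrightarrow>
     B \<subseteq> X \<and> indep M B \<and> (\<forall>I. I \<subseteq> X \<and> indep M I \<and> B \<subseteq> I \<longrightarrow> I = B)"

definition circuit :: "'a matroid \<Rightarrow> 'a set \<Rightarrow> bool" where
  "circuit M C \<longleftrightarrow> C \<subseteq> ground M \<and> \<not> indep M C \<and> (\<forall>X. X \<subset> C \<longrightarrow> indep M X)"

definition is_circuit_matroid :: "'a matroid \<Rightarrow> bool" where
  "is_circuit_matroid M \<longleftrightarrow> circuit M (ground M)"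

definition is_loop :: "'a matroid \<Rightarrow> 'a \<Rightarrow> bool" where
  "is_loop M x \<longleftrightarrow> circuit M {x}"

definition parallel_pair :: "'a matroid \<Rightarrow> 'a \<Rightarrow> 'a \<Rightarrow> bool" where
  "parallel_pair M x y \<longleftrightarrow> x \<noteq> y \<and> circuit M {x, y}"

definition simple_matroid :: "'a matroid \<Rightarrow> bool" where
  "simple_matroid M \<longleftrightarrow>
     is_matroid M \<and> (\<forall>x. \<not> is_loop M x) \<and> (\<forall>x y. \<not> parallel_pair M x y)"

text \<open>Loops lie in no parallel class, and a non-loop that is parallel to no other element
  forms a parallel class of size one.\<close>

definition nonloops :: "'a matroid \<Rightarrow> 'a set" where
  "nonloops M = {x \<in> ground M. \<not> is_loop M x}"

definition parallel_classes :: "'a matroid \<Rightarrow> 'a set set" where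
  "parallel_classes M =
     nonloops M // {(x, y). x \<in> nonloops M \<and> y \<in> nonloops M \<and> (x = y \<or> parallel_pair M x y)}"

definition restrict_matroid :: "'a matroid \<Rightarrow> 'a set \<Rightarrow> 'a matroid" where
  "restrict_matroid M T =
     \<lparr>ground = ground M \<inter> T, indep = (\<lambda>X. X \<subseteq> T \<and> indep M X)\<rparr>"

definition contract :: "'a matroid \<Rightarrow> 'a set \<Rightarrow> 'a matroid" where
  "contract M T =
     \<lparr>ground = ground M - T,
      indep = (\<lambda>X. X \<subseteq> ground M - T \<and> (\<exists>B. basis_of M (ground M \<inter> T) B \<and> indep M (X \<union> B)))\<rparr>"

text \<open>The simplification depends on the selected representatives and is unique only up to
  isomorphism, hence a relation.\<close>

definition is_simplification :: "'a matroid \<Rightarrow> 'a matroid \<Rightarrow> bool" where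
  "is_simplification M N \<longleftrightarrow>
     (\<exists>T. T \<subseteq> nonloops M \<and> (\<forall>P\<in>parallel_classes M. \<exists>!x. x \<in> P \<inter> T) \<and>
          N = restrict_matroid M T)"

definition spike_with_tip :: "'a matroid \<Rightarrow> 'a \<Rightarrow> bool" where
  "spike_with_tip S t \<longleftrightarrow>
     simple_matroid S \<and> t \<in> ground S \<and>
     (\<exists>N. is_simplification (contract S {t}) N \<and> is_circuit_matroid N) \<and>
     (\<forall>P\<in>parallel_classes (contract S {t}). card P = 2)"

definition spike :: "'a matroid \<Rightarrow> bool" where
  "spike S \<longleftrightarrow> (\<exists>t. spike_with_tip S t)"

section \<open>\<open>\<Delta>\<close>-modular matrices and matroids\<close>

definition real_rank :: "int mat \<Rightarrow> nat" where
  "real_rank A = vec_space.rank (dim_row A) (map_mat real_of_int A)"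

definition modular_matrix :: "nat \<Rightarrow> int mat \<Rightarrow> bool" where
  "modular_matrix \<Delta> A \<longleftrightarrow>
     (\<forall>I J. I \<subseteq> {..<dim_row A} \<and> J \<subseteq> {..<dim_col A} \<and>
            card I = real_rank A \<and> card J = real_rank A \<longrightarrow>
            \<bar>det (submatrix A I J)\<bar> \<le> int \<Delta>)"

text \<open>The bijection \<open>f\<close> labels the columns of \<open>A\<close> by the elements of the ground set.\<close>

definition represented_by :: "'a matroid \<Rightarrow> int mat \<Rightarrow> bool" where
  "represented_by M A \<longleftrightarrow>
     (\<exists>f. bij_betw f (ground M) {..<dim_col A} \<and>
          (\<forall>X. X \<subseteq> ground M \<longrightarrow>
             rank_of M X = real_rank (submatrix A {..<dim_row A} (f ` X))))"

definition modular_matroids :: "nat \<Rightarrow> 'a matroid set" where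
  "modular_matroids \<Delta> =
     {M. is_matroid M \<and> (\<exists>A. modular_matrix \<Delta> A \<and> represented_by M A)}"

end

theory Submission
  imports Defs
begin

text \<open>
  Let a spike with tip \<open>t\<close> have \<open>r\<close> legs, and choose one element \<open>x\<^sub>i\<close> of each leg. In a
  representation, the other element of leg \<open>i\<close> is \<open>y\<^sub>i = a\<^sub>i x\<^sub>i + b\<^sub>i t\<close> with \<open>a\<^sub>i\<close> and \<open>b\<^sub>i\<close>
  nonzero, because \<open>{t, x\<^sub>i, y\<^sub>i}\<close> is a circuit of size three. The rank of the spike is \<open>r\<close>, so
  after a suitable choice of \<open>r\<close> rows every \<open>r\<close>-tuple of columns has a determinant, which is an
  integer of absolute value at most \<open>\<Delta>\<close>. Write \<open>c\<close> for the determinant of \<open>x\<^sub>1, \<dots>, x\<^sub>r\<close> and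
  \<open>g\<^sub>i\<close> for the one in which \<open>t\<close> takes the place of \<open>x\<^sub>i\<close>. By multilinearity, and because two
  copies of \<open>t\<close> give zero, replacing \<open>x\<^sub>i\<close> by \<open>y\<^sub>i\<close> for all \<open>i\<close> in a set \<open>Y\<close> turns \<open>c\<close> into
  \<open>(\<Prod>i\<in>Y. a\<^sub>i) (c + (\<Sum>i\<in>Y. e\<^sub>i))\<close>, where \<open>e\<^sub>i = b\<^sub>i g\<^sub>i / a\<^sub>i\<close>, and turns \<open>g\<^sub>j\<close> into
  \<open>g\<^sub>j (\<Prod>i\<in>Y. a\<^sub>i)\<close> if \<open>j \<notin> Y\<close> (\<open>rows_det_flip\<close>, \<open>rows_det_flip_with_tip\<close>). The circuit
  in the contraction by \<open>t\<close> makes every \<open>g\<^sub>i\<close>, hence every \<open>e\<^sub>i\<close>, nonzero.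

  The rest is arithmetic (\<open>card_le_of_bounded_flips\<close>). If all \<open>\<bar>a\<^sub>i\<bar>\<close> are one, the \<open>e\<^sub>i\<close> are
  nonzero integers; flipping exactly the legs with \<open>e\<^sub>i > 0\<close>, or exactly those with \<open>e\<^sub>i < 0\<close>,
  yields two numbers in \<open>[-\<Delta>, \<Delta>]\<close> that differ by \<open>\<Sum>\<bar>e\<^sub>i\<bar> \<ge> r\<close>, so \<open>r \<le> 2 \<Delta>\<close>.

  In general write \<open>\<bar>a\<^sub>i\<bar> = n\<^sub>i / m\<^sub>i\<close> in lowest terms, let \<open>K\<close> be the set of legs with
  \<open>\<bar>a\<^sub>i\<bar> \<noteq> 1\<close>, let \<open>k\<close> be its size and let \<open>M\<close> be the product of the \<open>m\<^sub>i\<close>. A number that remains an integer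
  after multiplication by any of the products \<open>\<Prod>i\<in>Y. a\<^sub>i\<close> with \<open>Y \<subseteq> K\<close> is a multiple of \<open>M\<close>
  (\<open>prod_denominators_divides\<close>). Two consequences follow. If some leg \<open>j\<close> lies outside \<open>K\<close>,
  choosing the larger of \<open>n\<^sub>i\<close> and \<open>m\<^sub>i\<close> on each leg of \<open>K\<close> gives \<open>2 ^ k \<le> \<Delta>\<close>. And for a
  leg outside \<open>K\<close> one has \<open>\<bar>e\<^sub>i\<bar> \<ge> M\<close>, so that the argument above yields
  \<open>r - k \<le> \<Delta> / U + \<Delta> / V\<close> for positive integers \<open>U\<close>, \<open>V\<close> whose product is the product of
  all \<open>n\<^sub>i m\<^sub>i\<close>. If \<open>K\<close> is nonempty, then \<open>U\<close> and \<open>V\<close> are not both one, which gives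
  \<open>r - k \<le> 3 \<Delta> / 2\<close>; together with \<open>2 k \<le> 2 ^ k \<le> \<Delta>\<close> this is \<open>r \<le> 2 \<Delta>\<close>. If \<open>K\<close> consists
  of all legs, the power bound for all legs but one suffices.
\<close>

section \<open>Integrality of scaled products\<close>

text \<open>The fractions \<open>\<alpha> i\<close> may cancel each other's denominators in a product over all of \<open>K\<close>; it is
  the freedom to choose the factors that forces \<open>g\<close> to absorb every denominator. In the
  induction step, both \<open>g\<close> and \<open>g * \<alpha> i\<close> are divisible by the earlier denominators, and the
  quotients differ by the reduced fraction \<open>\<alpha> i\<close>.\<close>

lemma prod_denominators_divides:
  fixes g :: real and \<alpha> :: "'i \<Rightarrow> real" and n m :: "'i \<Rightarrow> nat"
  assumes "finite K"
    and "\<And>i. i \<in> K \<Longrightarrow> \<alpha> i = real (n i) / real (m i) \<and> m i > 0 \<and> coprime (n i) (m i)"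
    and "\<And>Y. Y \<subseteq> K \<Longrightarrow> g * prod \<alpha> Y \<in> \<int>"
  shows "g / real (\<Prod>i\<in>K. m i) \<in> \<int>"
  using assms
proof (induction K arbitrary: g rule: finite_induct)
  case empty
  then show ?case using empty(2)[of "{}"] by simp
next
  case (insert i K)
  let ?M = "real (\<Prod>i\<in>K. m i)"
  have i: "\<alpha> i = real (n i) / real (m i)" "m i > 0" "coprime (n i) (m i)"
    using insert.prems(1)[of i] by auto
  have "g / ?M \<in> \<int>"
    by (rule insert.IH) (use insert.prems in auto)
  then obtain h where h: "g / ?M = of_int h" by (auto elim: Ints_cases)
  have "g * \<alpha> i / ?M \<in> \<int>"
  proof (rule insert.IH)
    fix Y assume Y: "Y \<subseteq> K"
    then have "i \<notin> Y" "finite Y" using insert.hyps finite_subset by auto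
    then have "g * \<alpha> i * prod \<alpha> Y = g * prod \<alpha> (insert i Y)" by simp
    also have "\<dots> \<in> \<int>" by (rule insert.prems(2)) (use Y in auto)
    finally show "g * \<alpha> i * prod \<alpha> Y \<in> \<int>" .
  qed (use insert.prems in auto)
  then obtain z where z: "g * \<alpha> i / ?M = of_int z" by (auto elim: Ints_cases)
  have "of_int h * \<alpha> i = (of_int z :: real)" using h z by (simp flip: h)
  then have "of_int (h * int (n i)) = (of_int (z * int (m i)) :: real)"
    using i by (simp add: field_simps)
  then have "h * int (n i) = z * int (m i)" by (simp only: of_int_eq_iff)
  then have "int (m i) dvd h * int (n i)" by simp
  moreover have "coprime (int (m i)) (int (n i))" using i(3) by (simp add: coprime_commute)
  ultimately have "int (m i) dvd h" by (simp add: coprime_dvd_mult_left_iff)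
  then obtain q where "h = int (m i) * q" by (auto elim: dvdE)
  then have "g / ?M / real (m i) = of_int q"
    using h i(2) by simp
  then have "g / (real (m i) * ?M) = of_int q"
    by (metis divide_divide_eq_left mult.commute)
  then show ?case using insert.hyps by simp
qed

lemma Ints_nonzero_abs_ge_1:
  fixes x :: real assumes "x \<in> \<int>" "x \<noteq> 0" shows "\<bar>x\<bar> \<ge> 1"
  using assms by (auto elim!: Ints_cases)

text \<open>Since \<open>g\<close> is a multiple of all denominators, multiplying it by the fractions that exceed one
  produces a multiple of \<open>\<Prod>i\<in>K. max (n i) (m i)\<close>, and each of these factors is at least two.\<close>

lemma two_power_nonunit_ratios_le:
  fixes g \<Delta> :: real and \<alpha> :: "'i \<Rightarrow> real" and n m :: "'i \<Rightarrow> nat"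
  assumes fin: "finite K"
    and frac: "\<And>i. i \<in> K \<Longrightarrow> \<alpha> i = real (n i) / real (m i) \<and> m i > 0 \<and> n i > 0 \<and> coprime (n i) (m i)"
    and ne1: "\<And>i. i \<in> K \<Longrightarrow> \<alpha> i \<noteq> 1"
    and ints: "\<And>Y. Y \<subseteq> K \<Longrightarrow> g * prod \<alpha> Y \<in> \<int>"
    and bound: "\<And>Y. Y \<subseteq> K \<Longrightarrow> \<bar>g * prod \<alpha> Y\<bar> \<le> \<Delta>"
    and "g \<noteq> 0"
  shows "2 ^ card K \<le> \<Delta>"
proof -
  let ?M = "real (\<Prod>i\<in>K. m i)"
  let ?Y = "{i\<in>K. n i > m i}"
  let ?h = "g / ?M"
  have "?M > 0" using frac fin by (auto intro!: prod_pos)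
  then have "?M \<noteq> 0" by simp
  have h1: "\<bar>?h\<bar> \<ge> 1"
    using prod_denominators_divides[OF fin, of \<alpha> n m g] frac ints \<open>g \<noteq> 0\<close> \<open>?M \<noteq> 0\<close>
    by (intro Ints_nonzero_abs_ge_1) auto
  have max2: "2 \<le> real (max (n i) (m i))" if "i \<in> K" for i
  proof -
    have "n i \<noteq> m i" using frac[OF that] ne1[OF that] by auto
    then show ?thesis using frac[OF that] by auto
  qed
  have "(2::real) ^ card K = (\<Prod>i\<in>K. 2)" by simp
  also have "\<dots> \<le> (\<Prod>i\<in>K. real (max (n i) (m i)))"
    using max2 by (intro prod_mono) auto
  also have "\<dots> = (\<Prod>i\<in>K. real (m i) * (if i \<in> ?Y then \<alpha> i else 1))"
    by (rule prod.cong) (use frac in \<open>auto simp: max_def\<close>)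
  also have "\<dots> = ?M * prod \<alpha> ?Y"
    using fin by (simp add: prod.distrib prod.If_cases Int_def conj_commute)
  also have "\<dots> \<le> \<bar>?h\<bar> * (?M * prod \<alpha> ?Y)"
  proof -
    have "prod \<alpha> ?Y \<ge> 0" using frac by (intro prod_nonneg) auto
    then have "0 \<le> ?M * prod \<alpha> ?Y" by (intro mult_nonneg_nonneg) (auto intro: prod_nonneg)
    then show ?thesis using mult_right_mono[OF h1] by simp
  qed
  also have "\<dots> = \<bar>g * prod \<alpha> ?Y\<bar>"
  proof -
    have "prod \<alpha> ?Y \<ge> 0" using frac by (intro prod_nonneg) auto
    with \<open>?M > 0\<close> show ?thesis by (simp only: abs_mult abs_divide abs_of_pos abs_of_nonneg) simp
  qed
  also have "\<dots> \<le> \<Delta>" by (rule bound) auto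
  finally show ?thesis .
qed

lemma two_mult_le_two_power: "k \<ge> 1 \<Longrightarrow> 2 * k \<le> (2::nat) ^ k"
proof (induction k rule: nat_induct_at_least)
  case (Suc k)
  then have "2 \<le> (2::nat) ^ k" using power_increasing[of 1 k "2::nat"] by simp
  with Suc show ?case by simp
qed simp

text \<open>In the application, \<open>I\<close> indexes the legs of the spike, \<open>c\<close> is the determinant of a transversal,
  \<open>e\<close> measures the effect of flipping a leg, and \<open>g i\<close> is the determinant in which the tip
  replaces leg \<open>i\<close>.\<close>

lemma card_le_of_bounded_flips:
  fixes a e g :: "'i \<Rightarrow> real" and c :: real and \<Delta> :: nat
  assumes fin: "finite I" and \<Delta>: "\<Delta> > 0"
    and a: "\<And>i. i \<in> I \<Longrightarrow> a i \<noteq> 0" and e: "\<And>i. i \<in> I \<Longrightarrow> e i \<noteq> 0"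
    and g: "\<And>i. i \<in> I \<Longrightarrow> g i \<noteq> 0"
    and F_int: "\<And>Y. Y \<subseteq> I \<Longrightarrow> prod a Y * (c + sum e Y) \<in> \<int>"
    and F_le: "\<And>Y. Y \<subseteq> I \<Longrightarrow> \<bar>prod a Y * (c + sum e Y)\<bar> \<le> \<Delta>"
    and G_int: "\<And>i Y. i \<in> I \<Longrightarrow> Y \<subseteq> I - {i} \<Longrightarrow> g i * prod a Y \<in> \<int>"
    and G_le: "\<And>i Y. i \<in> I \<Longrightarrow> Y \<subseteq> I - {i} \<Longrightarrow> \<bar>g i * prod a Y\<bar> \<le> \<Delta>"
  shows "card I \<le> 2 * \<Delta>"
proof (cases "card I \<le> 1")
  case True
  then show ?thesis using \<Delta> by linarith
next
  case False
  define \<alpha> where "\<alpha> i = \<bar>a i\<bar>" for i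
  have abs_prod: "\<bar>prod a Y\<bar> = prod \<alpha> Y" for Y
    by (simp add: \<alpha>_def abs_prod)
  have Ints_abs: "h * prod \<alpha> Y \<in> \<int>" if "h * prod a Y \<in> \<int>" for h Y
    using that by (cases "prod a Y \<ge> 0") (auto simp flip: abs_prod)
  have "\<exists>n m. \<alpha> i = real n / real m \<and> m > 0 \<and> n > 0 \<and> coprime n m" if i: "i \<in> I" for i
  proof -
    have "\<not> I \<subseteq> {i}" using False card_mono[of "{i}" I] by auto
    then obtain j where j: "j \<in> I" "j \<noteq> i" by auto
    have "g j * prod a {} \<in> \<int>" "g j * prod a {i} \<in> \<int>" by (rule G_int; use i j in auto)+
    then have "g j \<in> \<int>" "g j * a i \<in> \<int>" by simp_all
    then have "g j * a i / g j \<in> \<rat>" by (intro Rats_divide) (blast intro: Ints_subset_Rats[THEN subsetD])+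
    then have "a i \<in> \<rat>" using g[OF j(1)] by simp
    then obtain n m where nm: "m \<noteq> 0" "\<bar>a i\<bar> = real n / real m" "coprime n m"
      by (rule Rats_abs_nat_div_natE)
    have "n \<noteq> 0" using a[OF i] nm(2) by (metis abs_eq_0 div_0 of_nat_0)
    then have "\<alpha> i = real n / real m \<and> m > 0 \<and> n > 0 \<and> coprime n m"
      unfolding \<alpha>_def using nm by (metis bot_nat_0.not_eq_extremum)
    then show ?thesis by blast
  qed
  then obtain n where "\<forall>i\<in>I. \<exists>m. \<alpha> i = real (n i) / real m \<and> m > 0 \<and> n i > 0 \<and> coprime (n i) m"
    using bchoice[of I "\<lambda>i n. \<exists>m. \<alpha> i = real n / real m \<and> m > 0 \<and> n > 0 \<and> coprime n m"] by blast
  then obtain m where frac: "\<And>i. i \<in> I \<Longrightarrow> \<alpha> i = real (n i) / real (m i) \<and> m i > 0 \<and> n i > 0 \<and> coprime (n i) (m i)"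
    using bchoice[of I "\<lambda>i m. \<alpha> i = real (n i) / real m \<and> m > 0 \<and> n i > 0 \<and> coprime (n i) m"] by blast
  define K where "K = {i\<in>I. \<alpha> i \<noteq> 1}"
  have KI: "K \<subseteq> I" and finK: "finite K" using fin by (auto simp: K_def)
  have unit: "n i = 1 \<and> m i = 1" if "i \<in> I - K" for i
  proof -
    have "n i = m i" using that frac[of i] by (auto simp: K_def)
    then show ?thesis using frac[of i] that by auto
  qed
  have power_le: "2 ^ card L \<le> \<Delta>" if "j \<in> I" "L \<subseteq> K - {j}" for j L
  proof -
    have "(2::real) ^ card L \<le> \<Delta>"
    proof (rule two_power_nonunit_ratios_le)
      show "finite L" using that finK finite_subset by blast
      show "g j \<noteq> 0" using g that by blast
      fix Y assume "Y \<subseteq> L"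
      then have Y: "Y \<subseteq> I - {j}" using that KI by auto
      then show "g j * prod \<alpha> Y \<in> \<int>" by (intro Ints_abs G_int that)
      show "\<bar>g j * prod \<alpha> Y\<bar> \<le> \<Delta>"
        using G_le[OF that(1) Y] by (simp add: abs_mult flip: abs_prod)
    qed (use that frac KI in \<open>auto simp: K_def\<close>)
    then show ?thesis by (metis of_nat_le_iff of_nat_numeral of_nat_power)
  qed
  show ?thesis
  proof (cases "K = I")
    case True
    \<comment> \<open>Here no leg is left over for the tip, so one leg of \<open>K\<close> has to give way.\<close>
    obtain j where j: "j \<in> I" using False by fastforce
    have "card I = Suc (card (K - {j}))"
      using True j fin by (metis card_Suc_Diff1)
    moreover have "card (K - {j}) < 2 ^ card (K - {j})" by (rule less_exp)
    ultimately show ?thesis using power_le[OF j subset_refl] by linarith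
  next
    case False
    then obtain j where j: "j \<in> I" "j \<notin> K" using KI by auto
    define M where "M = real (\<Prod>i\<in>I. m i)"
    have MK: "M = real (\<Prod>i\<in>K. m i)"
      unfolding M_def using unit by (intro arg_cong[of _ _ real] prod.mono_neutral_right fin KI) auto
    have Mpos: "M > 0" unfolding M_def using frac fin by (auto intro!: prod_pos)
    \<comment> \<open>Flipping leg \<open>i\<close> changes the determinant by \<open>a i * e i\<close> times the product over \<open>Y\<close>, an
      integer because \<open>a i\<close> is a sign.\<close>
    have e_ge: "\<bar>e i\<bar> \<ge> M" if i: "i \<in> I - K" for i
    proof -
      have ai: "\<bar>a i\<bar> = 1" using i by (auto simp: K_def \<alpha>_def)
      have ints: "a i * e i * prod \<alpha> Y \<in> \<int>" if Y: "Y \<subseteq> K" for Y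
      proof -
        have fY: "finite Y" "i \<notin> Y" using Y finK finite_subset i by auto
        have aI: "a i \<in> \<int>" using ai by (auto simp: abs_if split: if_splits)
        have "prod a (insert i Y) * (c + sum e (insert i Y)) - a i * (prod a Y * (c + sum e Y)) \<in> \<int>"
        proof (rule Ints_diff)
          show "prod a (insert i Y) * (c + sum e (insert i Y)) \<in> \<int>"
            by (rule F_int) (use Y KI i in auto)
          show "a i * (prod a Y * (c + sum e Y)) \<in> \<int>"
            by (rule Ints_mult[OF aI F_int]) (use Y KI in auto)
        qed
        also have "prod a (insert i Y) * (c + sum e (insert i Y)) - a i * (prod a Y * (c + sum e Y))
            = a i * e i * prod a Y"
          using fY by (simp add: algebra_simps)
        finally show ?thesis by (rule Ints_abs)
      qed
      have "a i * e i / M \<in> \<int>"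
        unfolding MK by (rule prod_denominators_divides[OF finK _ ints]) (use frac KI in blast)
      moreover have "a i * e i / M \<noteq> 0" using a[of i] e[of i] i Mpos by simp
      ultimately have "\<bar>a i * e i / M\<bar> \<ge> 1" by (rule Ints_nonzero_abs_ge_1)
      then show ?thesis using Mpos ai by (simp add: abs_mult)
    qed
    \<comment> \<open>\<open>U\<close> and \<open>V\<close> are \<open>M\<close> times the products of the ratios over \<open>P\<close> and over \<open>N\<close>: the factor
      \<open>m i\<close> of \<open>M\<close> cancels the denominators of the flipped legs.\<close>
    define P where "P = {i\<in>I. e i > 0}"
    define N where "N = I - P"
    define U where "U = (\<Prod>i\<in>I. if i \<in> P then n i else m i)"
    define V where "V = (\<Prod>i\<in>I. if i \<in> P then m i else n i)"
    have PI: "P \<subseteq> I" and NI: "N \<subseteq> I" by (auto simp: P_def N_def)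
    have fPN: "finite P" "finite N" using fin PI NI finite_subset by auto
    have Upos: "U \<ge> 1" and Vpos: "V \<ge> 1"
      unfolding U_def V_def using frac fin by (auto simp: Suc_le_eq intro!: prod_pos)
    have U: "M * prod \<alpha> P = real U"
    proof -
      have "prod \<alpha> P = (\<Prod>i\<in>I. if i \<in> P then \<alpha> i else 1)"
        using fin PI by (simp add: prod.If_cases Int_absorb1)
      then have "M * prod \<alpha> P = (\<Prod>i\<in>I. real (m i) * (if i \<in> P then \<alpha> i else 1))"
        by (simp add: M_def prod.distrib)
      also have "\<dots> = (\<Prod>i\<in>I. real (if i \<in> P then n i else m i))"
        by (rule prod.cong) (use frac in auto)
      finally show ?thesis by (simp add: U_def)
    qed
    have V: "M * prod \<alpha> N = real V"
    proof -
      have "prod \<alpha> N = (\<Prod>i\<in>I. if i \<in> N then \<alpha> i else 1)"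
        using fin NI by (simp add: prod.If_cases Int_absorb1)
      then have "M * prod \<alpha> N = (\<Prod>i\<in>I. real (m i) * (if i \<in> N then \<alpha> i else 1))"
        by (simp add: M_def prod.distrib)
      also have "\<dots> = (\<Prod>i\<in>I. real (if i \<in> P then m i else n i))"
        by (rule prod.cong) (use frac in \<open>auto simp: N_def\<close>)
      finally show ?thesis by (simp add: V_def)
    qed
    have \<alpha>pos: "prod \<alpha> P > 0" "prod \<alpha> N > 0"
      using a PI NI by (auto intro!: prod_pos simp: \<alpha>_def)
    have upper: "(c + sum e P) / M \<le> \<Delta> / U"
    proof -
      have "prod \<alpha> P * (c + sum e P) \<le> prod \<alpha> P * \<bar>c + sum e P\<bar>"
        using \<alpha>pos by (intro mult_left_mono) auto
      also have "\<dots> \<le> \<Delta>" using F_le[OF PI] by (simp add: abs_mult abs_prod)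
      finally have "(c + sum e P) * (M * prod \<alpha> P) \<le> \<Delta> * M"
        using Mpos by (simp add: mult_ac)
      then show ?thesis unfolding U using Mpos Upos by (simp add: divide_simps mult_ac)
    qed
    have lower: "- (c + sum e N) / M \<le> \<Delta> / V"
    proof -
      have "prod \<alpha> N * (- (c + sum e N)) \<le> prod \<alpha> N * \<bar>c + sum e N\<bar>"
        using \<alpha>pos by (intro mult_left_mono) auto
      also have "\<dots> \<le> \<Delta>" using F_le[OF NI] by (simp add: abs_mult abs_prod)
      finally have "(- (c + sum e N)) * (M * prod \<alpha> N) \<le> \<Delta> * M"
        using Mpos by (simp add: mult_ac)
      then show ?thesis unfolding V using Mpos Vpos by (simp add: divide_simps mult_ac)
    qed
    have "real (card (I - K)) * M = (\<Sum>i\<in>I - K. M)" by simp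
    also have "\<dots> \<le> (\<Sum>i\<in>I - K. \<bar>e i\<bar>)" using e_ge by (intro sum_mono) auto
    also have "\<dots> \<le> (\<Sum>i\<in>I. \<bar>e i\<bar>)" using fin by (intro sum_mono2) auto
    also have "\<dots> = sum e P - sum e N"
    proof -
      have "I = P \<union> N" "P \<inter> N = {}" using PI by (auto simp: N_def)
      then have "(\<Sum>i\<in>I. \<bar>e i\<bar>) = (\<Sum>i\<in>P. \<bar>e i\<bar>) + (\<Sum>i\<in>N. \<bar>e i\<bar>)"
        using fPN by (simp add: sum.union_disjoint)
      also have "(\<Sum>i\<in>P. \<bar>e i\<bar>) = sum e P" by (rule sum.cong) (auto simp: P_def)
      also have "(\<Sum>i\<in>N. \<bar>e i\<bar>) = - sum e N"
        unfolding sum_negf[symmetric] by (rule sum.cong) (auto simp: P_def N_def)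
      finally show ?thesis by simp
    qed
    finally have "real (card (I - K)) \<le> (sum e P - sum e N) / M"
      using Mpos by (simp add: le_divide_eq)
    also have "\<dots> = (c + sum e P) / M + (- (c + sum e N)) / M"
      by (simp flip: add_divide_distrib)
    also have "\<dots> \<le> \<Delta> / U + \<Delta> / V" using upper lower by linarith
    finally have main: "real (card (I - K)) \<le> \<Delta> / U + \<Delta> / V" .
    have D1: "\<Delta> / U \<le> \<Delta>" "\<Delta> / V \<le> \<Delta>" using divide_left_mono[of 1 "real U" "real \<Delta>"] divide_left_mono[of 1 "real V" "real \<Delta>"] Upos Vpos
      by simp_all
    show ?thesis
    proof (cases "K = {}")
      case True
      then show ?thesis using main D1 by simp
    next
      case False
      then obtain i where i: "i \<in> K" by auto
      have "n i \<noteq> m i" using i frac[of i] by (auto simp: K_def)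
      have "U \<ge> 2 \<or> V \<ge> 2"
      proof -
        have "U = 1 \<and> V = 1 \<Longrightarrow> n i = m i"
          unfolding U_def V_def prod_eq_1_iff[OF fin] using i KI by (cases "i \<in> P") force+
        then show ?thesis using \<open>n i \<noteq> m i\<close> Upos Vpos by linarith
      qed
      then have "\<Delta> / U \<le> \<Delta> / 2 \<or> \<Delta> / V \<le> \<Delta> / 2"
        using divide_left_mono[of 2 "real U" "real \<Delta>"] divide_left_mono[of 2 "real V" "real \<Delta>"] Upos Vpos
        by auto
      then have "2 * real (card (I - K)) \<le> 3 * \<Delta>" using main D1 by (elim disjE) linarith+
      then have "2 * card (I - K) \<le> 3 * \<Delta>" by linarith
      moreover have "2 * card K \<le> \<Delta>"
        using power_le[OF j(1), of K] j two_mult_le_two_power[of "card K"] finK False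
        by (auto simp: Suc_le_eq card_gt_0_iff)
      moreover have "card I = card (I - K) + card K"
        using fin KI by (simp add: card_Diff_subset finK card_mono)
      ultimately show ?thesis by linarith
    qed
  qed
qed

section \<open>Determinants under multilinear flips\<close>

text \<open>The vectors are placed as rows and \<open>\<rho>\<close> selects the coordinates. In a representation the
  vectors are columns of a matrix, so this is a transposed minor, in an order of rows and columns
  that need not be increasing.\<close>

definition rows_det :: "nat \<Rightarrow> (nat \<Rightarrow> 'k) \<Rightarrow> (nat \<Rightarrow> 'k \<Rightarrow> real) \<Rightarrow> real" where
  "rows_det r \<rho> w = det (mat r r (\<lambda>(j, k). w j (\<rho> k)))"

lemma rows_det_linear:
  assumes i: "i < r"
  shows "rows_det r \<rho> (w(i := (\<lambda>k. a * u k + b * v k))) =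
         a * rows_det r \<rho> (w(i := u)) + b * rows_det r \<rho> (w(i := v))"
proof -
  have expand: "rows_det r \<rho> (w(i := z)) =
      (\<Sum>p | p permutes {0..<r}. signof p * z (\<rho> (p i)) * (\<Prod>j\<in>{0..<r} - {i}. w j (\<rho> (p j))))" for z
  proof -
    have "rows_det r \<rho> (w(i := z)) =
        (\<Sum>p | p permutes {0..<r}. signof p * (\<Prod>j = 0..<r. (w(i := z)) j (\<rho> (p j))))"
      unfolding rows_det_def det_def by (auto intro!: sum.cong prod.cong simp: permutes_def)
    also have "\<dots> = (\<Sum>p | p permutes {0..<r}. signof p * z (\<rho> (p i)) * (\<Prod>j\<in>{0..<r} - {i}. w j (\<rho> (p j))))"
    proof (rule sum.cong[OF refl])
      fix p
      have "(\<Prod>j = 0..<r. (w(i := z)) j (\<rho> (p j))) =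
          z (\<rho> (p i)) * (\<Prod>j\<in>{0..<r} - {i}. (w(i := z)) j (\<rho> (p j)))"
        using i by (subst prod.remove[of _ i]) auto
      also have "(\<Prod>j\<in>{0..<r} - {i}. (w(i := z)) j (\<rho> (p j))) = (\<Prod>j\<in>{0..<r} - {i}. w j (\<rho> (p j)))"
        by (rule prod.cong) auto
      finally show "signof p * (\<Prod>j = 0..<r. (w(i := z)) j (\<rho> (p j))) =
        signof p * z (\<rho> (p i)) * (\<Prod>j\<in>{0..<r} - {i}. w j (\<rho> (p j)))" by (simp add: mult.assoc)
    qed
    finally show ?thesis .
  qed
  show ?thesis
    unfolding expand by (simp add: sum_distrib_left distrib_left distrib_right sum.distrib mult_ac)
qed

lemma rows_det_equal_rows:
  assumes "i < r" "j < r" "i \<noteq> j" "w i = w j"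
  shows "rows_det r \<rho> w = 0"
  unfolding rows_det_def
  by (rule det_identical_rows[of _ r i j]) (use assms in \<open>auto intro!: eq_vecI\<close>)

text \<open>Expand the vanishing determinant that has \<open>u + v\<close> in both rows.\<close>

lemma rows_det_swap:
  assumes ij: "i < r" "j < r" "i \<noteq> j"
  shows "rows_det r \<rho> (w(i := u, j := v)) = - rows_det r \<rho> (w(i := v, j := u))"
proof -
  let ?s = "\<lambda>k. 1 * u k + 1 * v k"
  have "0 = rows_det r \<rho> (w(i := ?s, j := ?s))"
    using ij by (subst rows_det_equal_rows[of i r j]) auto
  also have "\<dots> = rows_det r \<rho> (w(i := ?s, j := u)) + rows_det r \<rho> (w(i := ?s, j := v))"
    using ij by (subst rows_det_linear) auto
  also have "\<dots> = rows_det r \<rho> (w(j := u, i := ?s)) + rows_det r \<rho> (w(j := v, i := ?s))"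
    using ij by (simp add: fun_upd_twist)
  also have "\<dots> = rows_det r \<rho> (w(j := u, i := u)) + rows_det r \<rho> (w(j := u, i := v)) +
      (rows_det r \<rho> (w(j := v, i := u)) + rows_det r \<rho> (w(j := v, i := v)))"
    using rows_det_linear[OF ij(1), of \<rho> "w(j := u)" 1 u 1 v]
      rows_det_linear[OF ij(1), of \<rho> "w(j := v)" 1 u 1 v] by simp
  also have "rows_det r \<rho> (w(j := u, i := u)) = 0"
    using ij by (intro rows_det_equal_rows[of i r j]) auto
  also have "rows_det r \<rho> (w(j := v, i := v)) = 0"
    using ij by (intro rows_det_equal_rows[of i r j]) auto
  finally show ?thesis unfolding fun_upd_twist[OF ij(3), of w] by linarith
qed

lemma rows_det_sum:
  assumes i: "i < r" and "finite J"
  shows "rows_det r \<rho> (w(i := (\<lambda>k. \<Sum>j\<in>J. c j * u j k))) =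
         (\<Sum>j\<in>J. c j * rows_det r \<rho> (w(i := u j)))"
  using assms(2)
proof (induction J rule: finite_induct)
  case empty
  have "rows_det r \<rho> (w(i := (\<lambda>k. 0 * w i k + 0 * w i k))) = 0"
    unfolding rows_det_linear[OF i] by simp
  then show ?case by (simp only: sum.empty mult_zero_left add_0_left)
next
  case (insert j J)
  have "rows_det r \<rho> (w(i := (\<lambda>k. c j * u j k + 1 * (\<Sum>j\<in>J. c j * u j k)))) =
    c j * rows_det r \<rho> (w(i := u j)) + 1 * rows_det r \<rho> (w(i := (\<lambda>k. \<Sum>j\<in>J. c j * u j k)))"
    by (rule rows_det_linear[OF i])
  then show ?case unfolding sum.insert[OF insert.hyps] mult_1_left insert.IH .
qed

text \<open>With \<open>t\<close> already present in row \<open>i\<close>, the summand \<open>b j * t\<close> of any flipped row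
  contributes nothing.\<close>

lemma rows_det_flip_with_tip:
  assumes "finite Y" "Y \<subseteq> {..<r} - {i}" "i < r"
  shows "rows_det r \<rho> ((\<lambda>j. if j \<in> Y then (\<lambda>k. a j * x j k + b j * t k) else x j)(i := t)) =
         prod a Y * rows_det r \<rho> (x(i := t))"
  using assms
proof (induction Y rule: finite_induct)
  case empty
  then show ?case by simp
next
  case (insert l Y)
  let ?z = "\<lambda>Y j. if j \<in> Y then (\<lambda>k. a j * x j k + b j * t k) else x j"
  have l: "l < r" "l \<noteq> i" using insert.prems by auto
  have "(?z (insert l Y))(i := t) = ((?z Y)(i := t))(l := (\<lambda>k. a l * x l k + b l * t k))"
    using l by auto
  then have "rows_det r \<rho> ((?z (insert l Y))(i := t)) =
      a l * rows_det r \<rho> (((?z Y)(i := t))(l := x l)) + b l * rows_det r \<rho> (((?z Y)(i := t))(l := t))"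
    using l by (simp only: rows_det_linear)
  also have "((?z Y)(i := t))(l := x l) = (?z Y)(i := t)" using insert.hyps l by auto
  also have "rows_det r \<rho> (((?z Y)(i := t))(l := t)) = 0"
    using l insert.prems by (intro rows_det_equal_rows[of i r l]) auto
  finally show ?case using insert by simp
qed

text \<open>Each term of the expansion that uses \<open>t\<close> in two rows vanishes, so the determinant depends on
  the set of flipped rows affinely, up to the scaling factor.\<close>

lemma rows_det_flip:
  assumes "finite Y" "Y \<subseteq> {..<r}" "\<And>i. i \<in> Y \<Longrightarrow> a i \<noteq> 0"
  shows "rows_det r \<rho> (\<lambda>j. if j \<in> Y then (\<lambda>k. a j * x j k + b j * t k) else x j) =
         prod a Y * (rows_det r \<rho> x + (\<Sum>i\<in>Y. b i * rows_det r \<rho> (x(i := t)) / a i))"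
  using assms
proof (induction Y rule: finite_induct)
  case empty
  then show ?case by simp
next
  case (insert l Y)
  let ?z = "\<lambda>Y j. if j \<in> Y then (\<lambda>k. a j * x j k + b j * t k) else x j"
  have l: "l < r" "a l \<noteq> 0" using insert.prems by auto
  have "?z (insert l Y) = (?z Y)(l := (\<lambda>k. a l * x l k + b l * t k))" by auto
  then have "rows_det r \<rho> (?z (insert l Y)) =
      a l * rows_det r \<rho> ((?z Y)(l := x l)) + b l * rows_det r \<rho> ((?z Y)(l := t))"
    using l by (simp only: rows_det_linear)
  also have "(?z Y)(l := x l) = ?z Y" using insert.hyps by auto
  also have "rows_det r \<rho> ((?z Y)(l := t)) = prod a Y * rows_det r \<rho> (x(l := t))"
    using insert.hyps insert.prems by (intro rows_det_flip_with_tip) auto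
  also have "rows_det r \<rho> (?z Y) = prod a Y * (rows_det r \<rho> x + (\<Sum>i\<in>Y. b i * rows_det r \<rho> (x(i := t)) / a i))"
    by (rule insert.IH) (use insert.prems in auto)
  finally have step: "rows_det r \<rho> (?z (insert l Y)) =
    a l * (prod a Y * (rows_det r \<rho> x + (\<Sum>i\<in>Y. b i * rows_det r \<rho> (x(i := t)) / a i))) +
    b l * (prod a Y * rows_det r \<rho> (x(l := t)))" .
  show ?case
    unfolding step prod.insert[OF insert.hyps] sum.insert[OF insert.hyps]
    using l(2) by (simp only: distrib_left times_divide_eq_right) (simp add: mult_ac)
qed

text \<open>Independent vectors have a nonzero minor of full size. Given coordinates \<open>\<rho>\<close> that work for the
  first \<open>r\<close> vectors, append one further coordinate \<open>s\<close> and expand along its column: the cofactors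
  do not depend on \<open>s\<close>, and the last of them is nonzero. If the determinant vanished for every
  \<open>s\<close>, the cofactors would be the coefficients of a linear relation.\<close>

lemma exists_nonzero_minor:
  fixes w :: "nat \<Rightarrow> 'k \<Rightarrow> real"
  assumes "\<And>c. (\<forall>k\<in>R. (\<Sum>j<r. c j * w j k) = 0) \<Longrightarrow> \<forall>j<r. c j = 0"
  shows "\<exists>\<rho>. \<rho> ` {..<r} \<subseteq> R \<and> rows_det r \<rho> w \<noteq> 0"
  using assms
proof (induction r)
  case 0
  show ?case by (auto simp: rows_det_def)
next
  case (Suc r)
  have "\<exists>\<rho>. \<rho> ` {..<r} \<subseteq> R \<and> rows_det r \<rho> w \<noteq> 0"
  proof (rule Suc.IH)
    fix c assume c: "\<forall>k\<in>R. (\<Sum>j<r. c j * w j k) = 0"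
    define c' where "c' j = (if j = r then 0 else c j)" for j
    have "(\<Sum>j<Suc r. c' j * w j k) = (\<Sum>j<r. c j * w j k)" for k
      by (auto simp: c'_def intro: sum.cong)
    then have "\<forall>j<Suc r. c' j = 0" using c by (intro Suc.prems) simp
    then show "\<forall>j<r. c j = 0" by (metis c'_def less_Suc_eq nat_neq_iff)
  qed
  then obtain \<rho> where \<rho>: "\<rho> ` {..<r} \<subseteq> R" "rows_det r \<rho> w \<noteq> 0" by auto
  define B where "B s = mat (Suc r) (Suc r) (\<lambda>(j, k). w j ((\<rho>(r := s)) k))" for s
  define C where "C j = det (mat r r (\<lambda>(l, k). w (if l < j then l else Suc l) (\<rho> k))) * (-1) ^ (j + r)" for j
  have cof: "cofactor (B s) j r = C j" if "j < Suc r" for s j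
  proof -
    have "mat_delete (B s) j r = mat r r (\<lambda>(l, k). w (if l < j then l else Suc l) (\<rho> k))"
      by (rule eq_matI) (auto simp: mat_delete_def B_def)
    then show ?thesis by (simp add: cofactor_def C_def)
  qed
  have det_B: "rows_det (Suc r) (\<rho>(r := s)) w = (\<Sum>j<Suc r. C j * w j s)" for s
  proof -
    have "rows_det (Suc r) (\<rho>(r := s)) w = (\<Sum>j<Suc r. B s $$ (j, r) * cofactor (B s) j r)"
      unfolding rows_det_def B_def[symmetric] by (rule laplace_expansion_column) (auto simp: B_def)
    also have "\<dots> = (\<Sum>j<Suc r. C j * w j s)"
    proof (rule sum.cong[OF refl])
      fix j assume "j \<in> {..<Suc r}"
      moreover from this have "B s $$ (j, r) = w j s" by (simp add: B_def)
      ultimately show "B s $$ (j, r) * cofactor (B s) j r = C j * w j s" by (simp add: cof)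
    qed
    finally show ?thesis .
  qed
  have "mat r r (\<lambda>(l, k). w (if l < r then l else Suc l) (\<rho> k)) = mat r r (\<lambda>(l, k). w l (\<rho> k))"
    by (rule eq_matI) auto
  then have "C r \<noteq> 0" using \<rho>(2) by (simp add: C_def rows_det_def)
  then have "\<not> (\<forall>k\<in>R. (\<Sum>j<Suc r. C j * w j k) = 0)" using Suc.prems[of C] by blast
  then obtain s where s: "s \<in> R" "rows_det (Suc r) (\<rho>(r := s)) w \<noteq> 0" by (auto simp: det_B)
  have "(\<rho>(r := s)) ` {..<Suc r} \<subseteq> R" using \<rho>(1) s(1) by (auto simp: less_Suc_eq)
  with s(2) show ?case by blast
qed

section \<open>Column rank and maximal minors\<close>

lemma (in vec_space) rank_eq_ncols_iff_kernel_trivial: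
  assumes A: "A \<in> carrier_mat n nc"
  shows "rank A = nc \<longleftrightarrow> (\<forall>v\<in>carrier_vec nc. A *\<^sub>v v = 0\<^sub>v n \<longrightarrow> v = 0\<^sub>v nc)"
proof (cases "distinct (cols A)")
  case True
  show ?thesis
  proof
    assume "rank A = nc"
    then show "\<forall>v\<in>carrier_vec nc. A *\<^sub>v v = 0\<^sub>v n \<longrightarrow> v = 0\<^sub>v nc"
      using full_rank_lin_indpt[OF A _ True] lin_depI[OF A _ _ _ True] by blast
  next
    assume "\<forall>v\<in>carrier_vec nc. A *\<^sub>v v = 0\<^sub>v n \<longrightarrow> v = 0\<^sub>v nc"
    then have "lin_indpt (set (cols A))" using lin_depE[OF A _ True] by metis
    then show "rank A = nc" by (rule lin_indpt_full_rank[OF A True])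
  qed
next
  case False
  obtain S where S: "maximal S (\<lambda>T. T \<subseteq> set (cols A) \<and> lin_indpt T)"
    using maximal_exists[of "(\<lambda>T. T \<subseteq> set (cols A) \<and> lin_indpt T)" "card (set (cols A))" "{}"]
    by (meson List.finite_set card_mono empty_iff empty_subsetI finite_lin_indpt2 rev_finite_subset)
  have "rank A = card S" by (rule rank_card_indpt[OF A S])
  also have "\<dots> \<le> card (set (cols A))" using S by (simp add: card_mono maximal_def)
  also have "\<dots> < length (cols A)" using False card_length card_distinct le_neq_implies_less by blast
  finally have "rank A \<noteq> nc" using A by simp
  moreover
  obtain i j where ij: "i < nc" "j < nc" "i \<noteq> j" "col A i = col A j"
    using False A by (auto simp: distinct_conv_nth)
  have "A *\<^sub>v unit_vec nc l = col A l" if "l < nc" for l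
    by (rule eq_vecI) (use A that in \<open>auto simp: scalar_prod_right_unit[of _ nc]\<close>)
  then have "A *\<^sub>v (unit_vec nc i - unit_vec nc j) = 0\<^sub>v n"
    using A ij by (simp add: mult_minus_distrib_mat_vec[of _ n nc])
  moreover have "unit_vec nc i - unit_vec nc j \<noteq> (0\<^sub>v nc :: 'a vec)"
  proof
    assume "unit_vec nc i - unit_vec nc j = (0\<^sub>v nc :: 'a vec)"
    then have "(unit_vec nc i - unit_vec nc j) $ i = (0\<^sub>v nc :: 'a vec) $ i" by simp
    then show False using ij by simp
  qed
  ultimately show ?thesis by (meson minus_carrier_vec unit_vec_carrier)
qed

text \<open>Extending columns by zero makes linear relations between them equations between functions.\<close>

definition col_fun :: "int mat \<Rightarrow> nat \<Rightarrow> nat \<Rightarrow> real" where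
  "col_fun A j k = (if k < dim_row A then real_of_int (A $$ (k, j)) else 0)"

lemma bij_betw_pick: "finite J \<Longrightarrow> bij_betw (pick J) {..<card J} J"
proof -
  assume J: "finite J"
  have "inj_on (pick J) {..<card J}"
    by (rule linorder_inj_onI') (metis lessThan_iff nat_neq_iff pick_mono_le)
  moreover have "pick J ` {..<card J} \<subseteq> J" by (auto intro: pick_in_set_le)
  ultimately show ?thesis
    using J card_image[of "pick J" "{..<card J}"] card_subset_eq[of J] by (auto simp: bij_betw_def)
qed

lemma pick_lessThan: "k < n \<Longrightarrow> pick {..<n} k = k"
proof -
  assume k: "k < n"
  then have "{a \<in> {..<n}. a < k} = {..<k}" by auto
  then show ?thesis using pick_card_in_set[of k "{..<n}"] k by simp
qed

lemma submatrix_all: "submatrix A {..<dim_row A} {..<dim_col A} = A"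
  by (rule eq_matI) (simp_all add: submatrix_def pick_lessThan)

lemma real_rank_submatrix_full_iff:
  assumes J: "J \<subseteq> {..<dim_col A}"
  shows "real_rank (submatrix A {..<dim_row A} J) = card J \<longleftrightarrow>
    (\<forall>c. (\<forall>k. (\<Sum>j\<in>J. c j * col_fun A j k) = 0) \<longrightarrow> (\<forall>j\<in>J. c j = 0))"
proof -
  let ?n = "dim_row A"
  define B where "B = map_mat real_of_int (submatrix A {..<?n} J)"
  have fJ: "finite J" using J finite_subset by blast
  have Jset: "{j. j < dim_col A \<and> j \<in> J} = J" using J by auto
  have B: "B \<in> carrier_mat ?n (card J)"
    by (simp add: B_def submatrix_def Jset)
  have rank: "real_rank (submatrix A {..<?n} J) = vec_space.rank ?n B"
    by (simp add: real_rank_def B_def dim_submatrix)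
  have B_index: "B $$ (k, p) = col_fun A (pick J p) k" if "k < ?n" "p < card J" for k p
    using that by (simp add: B_def submatrix_def Jset pick_lessThan col_fun_def)
  have mult: "(B *\<^sub>v vec (card J) (\<lambda>p. c (pick J p))) $ k = (\<Sum>j\<in>J. c j * col_fun A j k)"
    if "k < ?n" for k c
  proof -
    have "(B *\<^sub>v vec (card J) (\<lambda>p. c (pick J p))) $ k =
        (\<Sum>p<card J. c (pick J p) * col_fun A (pick J p) k)"
      using that B by (auto simp: scalar_prod_def B_index lessThan_atLeast0 mult.commute intro!: sum.cong)
    also have "\<dots> = (\<Sum>j\<in>J. c j * col_fun A j k)"
      by (rule sum.reindex_bij_betw[OF bij_betw_pick[OF fJ]])
    finally show ?thesis .
  qed
  have zero_iff: "B *\<^sub>v vec (card J) (\<lambda>p. c (pick J p)) = 0\<^sub>v ?n \<longleftrightarrow>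
      (\<forall>k. (\<Sum>j\<in>J. c j * col_fun A j k) = 0)" for c
  proof
    assume z: "B *\<^sub>v vec (card J) (\<lambda>p. c (pick J p)) = 0\<^sub>v ?n"
    show "\<forall>k. (\<Sum>j\<in>J. c j * col_fun A j k) = 0"
    proof
      fix k
      show "(\<Sum>j\<in>J. c j * col_fun A j k) = 0"
      proof (cases "k < ?n")
        case True
        then show ?thesis using mult[OF True, of c] z by simp
      qed (simp add: col_fun_def)
    qed
  qed (use B mult in \<open>auto intro!: eq_vecI\<close>)
  have vec_zero_iff: "vec (card J) (\<lambda>p. c (pick J p)) = 0\<^sub>v (card J) \<longleftrightarrow> (\<forall>j\<in>J. c j = 0)" for c :: "nat \<Rightarrow> real"
  proof -
    have "vec (card J) (\<lambda>p. c (pick J p)) = 0\<^sub>v (card J) \<longleftrightarrow> (\<forall>p\<in>{..<card J}. c (pick J p) = 0)"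
      by (auto simp: vec_eq_iff)
    also have "\<dots> \<longleftrightarrow> (\<forall>j\<in>pick J ` {..<card J}. c j = 0)" by blast
    also have "pick J ` {..<card J} = J" using bij_betw_pick[OF fJ] by (simp add: bij_betw_def)
    finally show ?thesis .
  qed
  have vec_ex: "\<exists>c. v = vec (card J) (\<lambda>p. c (pick J p))" if "v \<in> carrier_vec (card J)" for v :: "real vec"
  proof (intro exI[of _ "\<lambda>j. v $ (inv_into {..<card J} (pick J) j)"] eq_vecI)
    fix p assume "p < dim_vec (vec (card J) (\<lambda>p. v $ inv_into {..<card J} (pick J) (pick J p)))"
    then show "v $ p = vec (card J) (\<lambda>p. v $ inv_into {..<card J} (pick J) (pick J p)) $ p"
      using bij_betw_pick[OF fJ] by (simp add: bij_betw_def inv_into_f_f)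
  qed (use that in simp)
  have "(\<forall>v\<in>carrier_vec (card J). B *\<^sub>v v = 0\<^sub>v ?n \<longrightarrow> v = 0\<^sub>v (card J)) \<longleftrightarrow>
      (\<forall>c. B *\<^sub>v vec (card J) (\<lambda>p. c (pick J p)) = 0\<^sub>v ?n \<longrightarrow> vec (card J) (\<lambda>p. c (pick J p)) = 0\<^sub>v (card J))"
    using vec_ex by (metis vec_carrier)
  then show ?thesis
    unfolding rank vec_space.rank_eq_ncols_iff_kernel_trivial[OF B] zero_iff vec_zero_iff .
qed

text \<open>Submatrices list their rows in increasing order. A nonzero determinant forces the row selection
  \<open>s\<close> to be injective, and sorting it changes only the sign.\<close>

lemma det_pick_rows:
  fixes Q :: "nat \<Rightarrow> nat \<Rightarrow> 'b :: linordered_idom"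
  assumes nz: "det (mat r r (\<lambda>(i, j). Q (s i) j)) \<noteq> 0"
  shows "card (s ` {..<r}) = r \<and>
    \<bar>det (mat r r (\<lambda>(i, j). Q (s i) j))\<bar> = \<bar>det (mat r r (\<lambda>(i, j). Q (pick (s ` {..<r}) i) j))\<bar>"
proof -
  let ?S = "s ` {..<r}"
  have inj: "inj_on s {..<r}"
  proof (rule inj_onI, rule ccontr)
    fix i j assume "i \<in> {..<r}" "j \<in> {..<r}" "s i = s j" "i \<noteq> j"
    then have "det (mat r r (\<lambda>(i, j). Q (s i) j)) = 0"
      by (intro det_identical_rows[of _ r i j]) (auto intro!: eq_vecI)
    with nz show False by simp
  qed
  then have card: "card ?S = r" by (simp add: card_image)
  have bij: "bij_betw (pick ?S) {..<r} ?S" using bij_betw_pick[of ?S] card by simp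
  define p where "p k = (if k < r then inv_into {..<r} (pick ?S) (s k) else k)" for k
  have pick_p: "pick ?S (p k) = s k" if "k < r" for k
    using that bij by (simp add: p_def bij_betw_def f_inv_into_f)
  have "bij_betw (inv_into {..<r} (pick ?S) \<circ> s) {..<r} {..<r}"
    by (rule bij_betw_trans[OF _ bij_betw_inv_into[OF bij]]) (use inj in \<open>simp add: bij_betw_def\<close>)
  then have "bij_betw p {0..<r} {0..<r}"
    by (subst bij_betw_cong[where g = "inv_into {..<r} (pick ?S) \<circ> s"])
       (auto simp: p_def lessThan_atLeast0)
  then have perm: "p permutes {0..<r}" by (rule bij_imp_permutes) (simp add: p_def)
  let ?P = "mat r r (\<lambda>(i, j). Q (pick ?S i) j)"
  have "mat r r (\<lambda>(i, j). Q (s i) j) = mat r r (\<lambda>(i, j). ?P $$ (p i, j))"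
    using permutes_in_image[OF perm] by (intro eq_matI) (auto simp: pick_p)
  then have "det (mat r r (\<lambda>(i, j). Q (s i) j)) = signof p * det ?P"
    using det_permute_rows[OF _ perm, of ?P] by simp
  then show ?thesis using card by (simp add: abs_mult sign_def)
qed

text \<open>Repeated rows or columns give determinant zero; otherwise \<open>det_pick_rows\<close>, applied to the
  columns and, after transposing, to the rows, identifies the absolute value with that of a
  maximal minor.\<close>

lemma abs_det_columns_le:
  assumes A: "modular_matrix \<Delta> A" and r: "r = real_rank A"
    and \<rho>: "\<rho> ` {..<r} \<subseteq> {..<dim_row A}" and s: "s ` {..<r} \<subseteq> {..<dim_col A}"
  shows "rows_det r \<rho> (\<lambda>j. col_fun A (s j)) \<in> \<int>"
    and "\<bar>rows_det r \<rho> (\<lambda>j. col_fun A (s j))\<bar> \<le> \<Delta>"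
proof -
  let ?S = "s ` {..<r}" and ?R = "\<rho> ` {..<r}"
  define d where "d = det (mat r r (\<lambda>(j, k). A $$ (\<rho> k, s j)))"
  have "mat r r (\<lambda>(j, k). col_fun A (s j) (\<rho> k)) = map_mat real_of_int (mat r r (\<lambda>(j, k). A $$ (\<rho> k, s j)))"
    using \<rho> by (intro eq_matI) (auto simp: col_fun_def)
  then have eq: "rows_det r \<rho> (\<lambda>j. col_fun A (s j)) = real_of_int d"
    by (simp add: rows_det_def d_def of_int_hom.hom_det)
  then show "rows_det r \<rho> (\<lambda>j. col_fun A (s j)) \<in> \<int>" by simp
  have "\<bar>d\<bar> \<le> int \<Delta>"
  proof (cases "d = 0")
    case False
    let ?T = "mat r r (\<lambda>(j, k). A $$ (\<rho> k, pick ?S j))"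
    have 1: "card ?S = r" "\<bar>d\<bar> = \<bar>det ?T\<bar>"
      using det_pick_rows[of r "\<lambda>j k. A $$ (\<rho> k, j)" s] False unfolding d_def by auto
    have "transpose_mat ?T = mat r r (\<lambda>(k, j). A $$ (\<rho> k, pick ?S j))"
      by (rule eq_matI) auto
    then have 2: "det ?T = det (mat r r (\<lambda>(k, j). A $$ (\<rho> k, pick ?S j)))"
      by (metis det_transpose mat_carrier)
    have 3: "card ?R = r" "\<bar>det ?T\<bar> = \<bar>det (mat r r (\<lambda>(k, j). A $$ (pick ?R k, pick ?S j)))\<bar>"
      using det_pick_rows[of r "\<lambda>k j. A $$ (k, pick ?S j)" \<rho>] False 1 unfolding 2 by auto
    have "{i. i < dim_row A \<and> i \<in> ?R} = ?R" "{j. j < dim_col A \<and> j \<in> ?S} = ?S"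
      using \<rho> s by auto
    then have "submatrix A ?R ?S = mat r r (\<lambda>(k, j). A $$ (pick ?R k, pick ?S j))"
      by (simp add: submatrix_def 1(1) 3(1))
    then have "\<bar>d\<bar> = \<bar>det (submatrix A ?R ?S)\<bar>" using 1 3 by simp
    then show ?thesis using A \<rho> s 1(1) 3(1) unfolding modular_matrix_def r by metis
  qed simp
  then show "\<bar>rows_det r \<rho> (\<lambda>j. col_fun A (s j))\<bar> \<le> \<Delta>" unfolding eq by linarith
qed

section \<open>Spikes and their representations\<close>

lemma indep_subset: "is_matroid M \<Longrightarrow> indep M Y \<Longrightarrow> X \<subseteq> Y \<Longrightarrow> indep M X"
  unfolding is_matroid_def by simp metis

lemma indep_subset_ground: "is_matroid M \<Longrightarrow> indep M X \<Longrightarrow> X \<subseteq> ground M"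
  unfolding is_matroid_def by simp

lemma indep_augment:
  "is_matroid M \<Longrightarrow> indep M X \<Longrightarrow> indep M Y \<Longrightarrow> card X < card Y \<Longrightarrow> \<exists>y\<in>Y - X. indep M (insert y X)"
  unfolding is_matroid_def by simp

lemma indep_iff_rank_of:
  assumes M: "is_matroid M" and X: "X \<subseteq> ground M"
  shows "indep M X \<longleftrightarrow> rank_of M X = card X"
proof -
  have fin: "finite X" using finite_subset[OF X] M by (simp add: is_matroid_def)
  let ?C = "card ` {I. I \<subseteq> X \<and> indep M I}"
  have fC: "finite ?C" using fin by simp
  have "indep M {}" using M by (simp add: is_matroid_def)
  then have ne: "?C \<noteq> {}" by blast
  show ?thesis
  proof
    assume "indep M X"
    then show "rank_of M X = card X"
      unfolding rank_of_def by (intro Max_eqI fC) (auto intro: card_mono fin)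
  next
    assume "rank_of M X = card X"
    then have "card X \<in> ?C" using Max_in[OF fC ne] by (simp add: rank_of_def)
    then obtain Y where "card X = card Y" "Y \<subseteq> X" "indep M Y" by blast
    moreover from this have "Y = X" using card_subset_eq[OF fin] by simp
    ultimately show "indep M X" by simp
  qed
qed

lemma rank_of_ground_eqI:
  assumes M: "is_matroid M" and B: "indep M B"
    and max: "\<And>y. y \<in> ground M - B \<Longrightarrow> \<not> indep M (insert y B)"
  shows "matroid_rank M = card B"
proof -
  have B_sub: "B \<subseteq> ground M" by (rule indep_subset_ground[OF M B])
  have "card J \<le> card B" if J: "indep M J" for J
  proof (rule ccontr)
    assume "\<not> card J \<le> card B"
    then obtain y where "y \<in> J - B" "indep M (insert y B)"
      using indep_augment[OF M B J] by auto
    moreover have "J \<subseteq> ground M" by (rule indep_subset_ground[OF M J])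
    ultimately show False using max by blast
  qed
  moreover have "finite (ground M)" using M by (simp add: is_matroid_def)
  ultimately show ?thesis
    unfolding rank_of_def using B B_sub by (intro Max_eqI) auto
qed

lemma simple_matroid_indep_pair:
  assumes M: "simple_matroid M" and xy: "x \<in> ground M" "y \<in> ground M"
  shows "indep M {x, y}"
proof -
  have mat: "is_matroid M" using M by (simp add: simple_matroid_def)
  then have empty: "indep M {}" by (simp add: is_matroid_def)
  have single: "indep M {z}" if "z \<in> ground M" for z
  proof (rule ccontr)
    assume "\<not> indep M {z}"
    then have "is_loop M z"
      using that empty by (auto simp: is_loop_def circuit_def psubset_eq subset_singleton_iff)
    then show False using M by (simp add: simple_matroid_def)
  qed
  show ?thesis
  proof (rule ccontr)
    assume dep: "\<not> indep M {x, y}"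
    then have "x \<noteq> y" using single xy by auto
    have "indep M X" if "X \<subset> {x, y}" for X
    proof -
      have "X \<subseteq> {x} \<or> X \<subseteq> {y}" using that by auto
      then show ?thesis using indep_subset[OF mat] single xy by blast
    qed
    then have "parallel_pair M x y"
      using dep xy \<open>x \<noteq> y\<close> by (auto simp: parallel_pair_def circuit_def)
    then show False using M by (simp add: simple_matroid_def)
  qed
qed

lemma indep_contract_singleton:
  assumes M: "is_matroid M" and t: "indep M {t}"
  shows "indep (contract M {t}) X \<longleftrightarrow> X \<subseteq> ground M - {t} \<and> indep M (insert t X)"
proof -
  have "t \<in> ground M" using indep_subset_ground[OF M t] by simp
  then have g: "ground M \<inter> {t} = {t}" by auto
  have "basis_of M {t} B \<longleftrightarrow> B = {t}" for B
    unfolding basis_of_def using t by auto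
  then show ?thesis by (simp add: contract_def g)
qed

text \<open>A simplification of the contraction picks out a transversal \<open>T\<close> of the legs. That it is a
  circuit gives the second and third facts, and the size of the parallel classes gives the fourth.
  The contraction of a simple matroid by one element has no loops, so its parallel classes
  exhaust its ground set; as \<open>T\<close> meets each of them, the last fact follows.\<close>

lemma spike_transversal:
  assumes "spike_with_tip S t"
  obtains T where "T \<subseteq> ground S - {t}" "\<not> indep S (insert t T)"
    "\<And>X. X \<subset> T \<Longrightarrow> indep S (insert t X)"
    "\<And>x. x \<in> T \<Longrightarrow> \<exists>y\<in>ground S - {t, x}. \<not> indep S {t, x, y}"
    "\<And>y. y \<in> ground S - insert t T \<Longrightarrow> \<exists>x\<in>T. \<not> indep S {t, x, y}"
proof -
  let ?C = "contract S {t}"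
  have simple: "simple_matroid S" and t: "t \<in> ground S"
    and classes: "\<And>P. P \<in> parallel_classes ?C \<Longrightarrow> card P = 2"
    using assms by (auto simp: spike_with_tip_def)
  obtain T where T: "T \<subseteq> nonloops ?C" "\<forall>P\<in>parallel_classes ?C. \<exists>!x. x \<in> P \<inter> T"
      "circuit (restrict_matroid ?C T) (ground (restrict_matroid ?C T))"
    using assms by (auto simp: spike_with_tip_def is_simplification_def is_circuit_matroid_def)
  have mat: "is_matroid S" using simple by (simp add: simple_matroid_def)
  have indep_t: "indep S {t}" using simple_matroid_indep_pair[OF simple t t] by simp
  note indep_C = indep_contract_singleton[OF mat indep_t]
  have ground_C: "ground ?C = ground S - {t}" by (simp add: contract_def)
  have nonloops: "nonloops ?C = ground S - {t}"
    using simple_matroid_indep_pair[OF simple t]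
    by (auto simp: nonloops_def is_loop_def circuit_def indep_C ground_C)
  have T_sub: "T \<subseteq> ground S - {t}" using T(1) nonloops by simp
  let ?r = "{(x, y). x \<in> nonloops ?C \<and> y \<in> nonloops ?C \<and> (x = y \<or> parallel_pair ?C x y)}"
  have cls: "?r `` {x} \<in> parallel_classes ?C" if "x \<in> ground S - {t}" for x
    unfolding parallel_classes_def using that by (intro quotientI) (simp add: nonloops)
  have parallel: "\<not> indep S {t, x, y}" if "parallel_pair ?C x y" for x y
    using that by (auto simp: parallel_pair_def circuit_def indep_C ground_C)
  show thesis
  proof (rule that[OF T_sub])
    have gr: "ground (restrict_matroid ?C T) = T"
      using T_sub by (auto simp: restrict_matroid_def ground_C)
    then have circ: "circuit (restrict_matroid ?C T) T" using T(3) by simp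
    show "\<not> indep S (insert t T)"
      using circ T_sub by (auto simp: circuit_def restrict_matroid_def indep_C)
    show "indep S (insert t X)" if "X \<subset> T" for X
      using circ that by (auto simp: circuit_def restrict_matroid_def indep_C)
  next
    fix x assume x: "x \<in> T"
    let ?P = "?r `` {x}"
    have "card ?P = 2" using classes cls T_sub x by blast
    then have "\<not> ?P \<subseteq> {x}" using card_mono[of "{x}" ?P] by auto
    then obtain y where "y \<in> ?P" "y \<noteq> x" by blast
    then show "\<exists>y\<in>ground S - {t, x}. \<not> indep S {t, x, y}"
      using parallel by (auto simp: nonloops)
  next
    fix y assume y: "y \<in> ground S - insert t T"
    then have "?r `` {y} \<in> parallel_classes ?C" by (intro cls) auto
    then obtain x where "x \<in> ?r `` {y}" "x \<in> T" using T(2) by blast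
    then have "parallel_pair ?C y x" using y by auto
    then show "\<exists>x\<in>T. \<not> indep S {t, x, y}"
      using parallel \<open>x \<in> T\<close> by (metis insert_commute)
  qed
qed

definition indep_vecs :: "('a \<Rightarrow> 'k \<Rightarrow> real) \<Rightarrow> 'a set \<Rightarrow> bool" where
  "indep_vecs v X \<longleftrightarrow> (\<forall>c. (\<forall>k. (\<Sum>x\<in>X. c x * v x k) = 0) \<longrightarrow> (\<forall>x\<in>X. c x = 0))"

lemma indep_vecsD:
  "indep_vecs v X \<Longrightarrow> (\<And>k. (\<Sum>x\<in>X. c x * v x k) = 0) \<Longrightarrow> x \<in> X \<Longrightarrow> c x = 0"
  unfolding indep_vecs_def by blast

lemma indep_vecs_image:
  assumes "inj_on f X"
  shows "indep_vecs v (f ` X) \<longleftrightarrow> indep_vecs (v \<circ> f) X"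
proof
  assume L: "indep_vecs v (f ` X)"
  show "indep_vecs (v \<circ> f) X"
    unfolding indep_vecs_def
  proof (intro allI impI ballI)
    fix c x assume c: "\<forall>k. (\<Sum>x\<in>X. c x * (v \<circ> f) x k) = 0" and x: "x \<in> X"
    define d where "d j = c (inv_into X f j)" for j
    have "(\<Sum>j\<in>f ` X. d j * v j k) = 0" for k
      using c assms by (simp add: sum.reindex d_def)
    from indep_vecsD[OF L this, of "f x"] x show "c x = 0" by (simp add: d_def assms)
  qed
next
  assume R: "indep_vecs (v \<circ> f) X"
  show "indep_vecs v (f ` X)"
    unfolding indep_vecs_def
  proof (intro allI impI ballI)
    fix c j assume c: "\<forall>k. (\<Sum>j\<in>f ` X. c j * v j k) = 0" and j: "j \<in> f ` X"
    have "(\<Sum>x\<in>X. (c \<circ> f) x * (v \<circ> f) x k) = 0" for k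
      using c assms by (simp add: sum.reindex)
    from indep_vecsD[OF R this] j show "c j = 0" by auto
  qed
qed

text \<open>Otherwise the relation would live on the independent set \<open>X - {x}\<close>.\<close>

lemma relation_coeff_nonzero:
  assumes fin: "finite X" and rel: "\<And>k. (\<Sum>z\<in>X. c z * v z k) = 0"
    and nz: "z \<in> X" "c z \<noteq> 0" and x: "x \<in> X" and ind: "indep_vecs v (X - {x})"
  shows "c x \<noteq> 0"
proof
  assume c: "c x = 0"
  have "(\<Sum>z\<in>X - {x}. c z * v z k) = 0" for k
    using rel[of k] c by (simp add: sum.remove[OF fin x])
  from indep_vecsD[OF ind this, of z] nz c show False by auto
qed

lemma third_vector_of_circuit:
  assumes dist: "x \<noteq> t" "y \<noteq> t" "x \<noteq> y" and dep: "\<not> indep_vecs v {t, x, y}"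
    and ind: "indep_vecs v {t, x}" "indep_vecs v {t, y}" "indep_vecs v {x, y}"
  obtains a b where "a \<noteq> 0" "b \<noteq> 0" "v y = (\<lambda>k. a * v x k + b * v t k)"
proof -
  obtain c z where rel: "\<And>k. (\<Sum>z\<in>{t, x, y}. c z * v z k) = 0" and z: "z \<in> {t, x, y}" "c z \<noteq> 0"
    using dep unfolding indep_vecs_def by blast
  have sets: "{t, x, y} - {y} = {t, x}" "{t, x, y} - {x} = {t, y}" "{t, x, y} - {t} = {x, y}"
    using dist by auto
  note nz = relation_coeff_nonzero[of "{t, x, y}" c v, OF _ rel z]
  have c: "c y \<noteq> 0" "c x \<noteq> 0" "c t \<noteq> 0"
    using nz[of y] nz[of x] nz[of t] ind sets by auto
  have "v y k = (- c x / c y) * v x k + (- c t / c y) * v t k" for k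
  proof -
    have "c t * v t k + (c x * v x k + c y * v y k) = 0" using rel[of k] dist by simp
    then have "c y * v y k = - c x * v x k - c t * v t k" by linarith
    then have "v y k = (- c x * v x k - c t * v t k) / c y"
      using c(1) by (metis nonzero_mult_div_cancel_left)
    then show ?thesis by (simp add: diff_divide_distrib)
  qed
  then show thesis using c by (intro that[of "- c x / c y" "- c t / c y"]) auto
qed

lemma represented_by_indep:
  assumes M: "is_matroid M" and f: "bij_betw f (ground M) {..<dim_col A}"
    and rank: "\<And>X. X \<subseteq> ground M \<Longrightarrow> rank_of M X = real_rank (submatrix A {..<dim_row A} (f ` X))"
    and X: "X \<subseteq> ground M"
  shows "indep M X \<longleftrightarrow> indep_vecs (\<lambda>x. col_fun A (f x)) X"
proof -
  have inj: "inj_on f X" using f X by (meson bij_betw_def inj_on_subset)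
  have J: "f ` X \<subseteq> {..<dim_col A}" using f X by (auto simp: bij_betw_def)
  have "indep M X \<longleftrightarrow> real_rank (submatrix A {..<dim_row A} (f ` X)) = card (f ` X)"
    using indep_iff_rank_of[OF M X] rank[OF X] inj by (simp add: card_image)
  also have "\<dots> \<longleftrightarrow> indep_vecs (col_fun A) (f ` X)"
    unfolding real_rank_submatrix_full_iff[OF J] indep_vecs_def ..
  also have "\<dots> \<longleftrightarrow> indep_vecs (\<lambda>x. col_fun A (f x)) X"
    using indep_vecs_image[OF inj, of "col_fun A"] by (simp add: comp_def)
  finally show ?thesis .
qed

text \<open>The legs are enumerated by \<open>h\<close>. The set \<open>B\<close>, in which the tip replaces the first leg of the
  transversal \<open>T\<close>, is shown to be a basis; its columns determine the choice \<open>\<rho>\<close> of rows.\<close>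

lemma spike_rank_le:
  assumes mat: "is_matroid S" and A: "modular_matrix \<Delta> A" and rep: "represented_by S A"
    and spike: "spike_with_tip S t" and \<Delta>: "\<Delta> > 0"
  shows "matroid_rank S \<le> 2 * \<Delta>"
proof -
  obtain f where f: "bij_betw f (ground S) {..<dim_col A}"
    and rank: "\<And>X. X \<subseteq> ground S \<Longrightarrow> rank_of S X = real_rank (submatrix A {..<dim_row A} (f ` X))"
    using rep by (auto simp: represented_by_def)
  define v where "v x = col_fun A (f x)" for x
  have indep_v: "indep S X \<longleftrightarrow> indep_vecs v X" if "X \<subseteq> ground S" for X
    using represented_by_indep[OF mat f rank that] unfolding v_def by simp
  have simple: "simple_matroid S" and t: "t \<in> ground S"
    using spike by (auto simp: spike_with_tip_def)
  note pair = simple_matroid_indep_pair[OF simple]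
  obtain T where T: "T \<subseteq> ground S - {t}" and T_dep: "\<not> indep S (insert t T)"
    and T_min: "\<And>X. X \<subset> T \<Longrightarrow> indep S (insert t X)"
    and partner: "\<And>x. x \<in> T \<Longrightarrow> \<exists>y\<in>ground S - {t, x}. \<not> indep S {t, x, y}"
    and cover: "\<And>y. y \<in> ground S - insert t T \<Longrightarrow> \<exists>x\<in>T. \<not> indep S {t, x, y}"
    using spike_transversal[OF spike] by blast
  have tT: "t \<notin> T" "insert t T \<subseteq> ground S" using T t by auto
  have "finite (ground S)" using mat by (simp add: is_matroid_def)
  then have finT: "finite T" using finite_subset[of T "ground S"] tT(2) by simp
  have "T \<noteq> {}" using T_dep pair[OF t t] by auto
  define r where "r = card T"
  have line: "\<exists>a b. a \<noteq> 0 \<and> b \<noteq> 0 \<and> v y = (\<lambda>k. a * v x k + b * v t k)"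
    if xy: "x \<in> T" "y \<in> ground S - {t, x}" "\<not> indep S {t, x, y}" for x y
  proof -
    have "x \<in> ground S" "x \<noteq> t" using that T by auto
    then have "\<not> indep_vecs v {t, x, y}" "indep_vecs v {t, x}" "indep_vecs v {t, y}" "indep_vecs v {x, y}"
      using that t pair indep_v[of "{t, x, y}"] indep_v[of "{t, x}"] indep_v[of "{t, y}"] indep_v[of "{x, y}"]
      by auto
    then obtain a b where "a \<noteq> 0" "b \<noteq> 0" "v y = (\<lambda>k. a * v x k + b * v t k)"
      using third_vector_of_circuit[of x t y v] \<open>x \<noteq> t\<close> xy(2) by auto
    then show ?thesis by blast
  qed
  have "\<exists>y a b. y \<in> ground S \<and> a \<noteq> 0 \<and> b \<noteq> 0 \<and> v y = (\<lambda>k. a * v x k + b * v t k)" if "x \<in> T" for x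
    using partner[OF that] line[OF that] by blast
  then obtain p a b where p: "\<And>x. x \<in> T \<Longrightarrow> p x \<in> ground S \<and> a x \<noteq> (0::real) \<and> b x \<noteq> (0::real) \<and>
      v (p x) = (\<lambda>k. a x * v x k + b x * v t k)"
    by metis

  obtain \<gamma> z where rel: "\<And>k. (\<Sum>x\<in>insert t T. \<gamma> x * v x k) = 0" and z: "z \<in> insert t T" "\<gamma> z \<noteq> 0"
    using T_dep indep_v[OF tT(2)] unfolding indep_vecs_def by blast
  have B_indep: "indep S (insert t (T - {x}))" if "x \<in> T" for x
    using T_min[of "T - {x}"] that by blast
  have \<gamma>: "\<gamma> x \<noteq> 0" if "x \<in> T" for x
  proof -
    have "insert t T - {x} = insert t (T - {x})" using that tT(1) by auto
    then have "indep_vecs v (insert t T - {x})"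
      using indep_v[of "insert t (T - {x})"] B_indep[OF that] tT(2) by auto
    then show ?thesis
      using finT that by (intro relation_coeff_nonzero[OF _ rel z]) auto
  qed

  obtain h where h: "bij_betw h {..<r} T"
    using ex_bij_betw_nat_finite[OF finT] by (auto simp: r_def lessThan_atLeast0)
  have r0: "r > 0" using \<open>T \<noteq> {}\<close> finT by (auto simp: r_def card_gt_0_iff)
  have hT: "h j \<in> T" if "j < r" for j using h that by (auto simp: bij_betw_def)
  have h_inj: "h i = h j \<longleftrightarrow> i = j" if "i < r" "j < r" for i j
    using h that by (auto simp: bij_betw_def inj_on_def)
  define B where "B = insert t (T - {h 0})"
  have card_B: "card B = r"
    using finT hT[OF r0] tT(1) r0 by (simp add: B_def r_def)
  have B: "indep S B" "B \<subseteq> ground S" "finite B"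
    using B_indep[OF hT[OF r0]] tT(2) finT by (auto simp: B_def)
  have "t \<in> B" by (simp add: B_def)

  define \<delta> where "\<delta> u = - \<gamma> u / \<gamma> (h 0)" for u
  have first: "v (h 0) = (\<lambda>k. \<Sum>x\<in>B. \<delta> x * v x k)"
  proof
    fix k
    have "insert t T = insert (h 0) B" "h 0 \<notin> B" using hT[OF r0] tT(1) by (auto simp: B_def)
    then have "\<gamma> (h 0) * v (h 0) k + (\<Sum>x\<in>B. \<gamma> x * v x k) = 0" using rel[of k] B(3) by simp
    then have "v (h 0) k = - (\<Sum>x\<in>B. \<gamma> x * v x k) / \<gamma> (h 0)"
      using \<gamma>[OF hT[OF r0]] by (simp add: field_simps)
    also have "\<dots> = (\<Sum>x\<in>B. \<delta> x * v x k)"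
      by (simp add: \<delta>_def sum_divide_distrib sum_negf)
    finally show "v (h 0) k = (\<Sum>x\<in>B. \<delta> x * v x k)" .
  qed

  \<comment> \<open>Every element outside \<open>B\<close> and \<open>T\<close> is a partner of some \<open>x \<in> T\<close>. If \<open>x\<close> lies in \<open>B\<close>, its
    partner depends on \<open>x\<close> and \<open>t\<close>; if \<open>x\<close> is the missing leg, substituting its expansion over
    \<open>B\<close> gives the relation \<open>c\<close>.\<close>
  have "matroid_rank S = card B"
  proof (rule rank_of_ground_eqI[OF mat B(1)])
    fix y assume y: "y \<in> ground S - B"
    show "\<not> indep S (insert y B)"
    proof
      assume ind: "indep S (insert y B)"
      have "y \<noteq> h 0"
        using ind T_dep hT[OF r0] by (metis B_def insert_Diff insert_commute)
      then have "y \<in> ground S - insert t T" using y by (auto simp: B_def)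
      then obtain x where x: "x \<in> T" "\<not> indep S {t, x, y}" using cover by blast
      have "x = h 0"
      proof (rule ccontr)
        assume "x \<noteq> h 0"
        then have "{t, x, y} \<subseteq> insert y B" using x(1) by (auto simp: B_def)
        then show False using indep_subset[OF mat ind] x(2) by blast
      qed
      have "y \<in> ground S - {t, x}" using y \<open>y \<noteq> h 0\<close> \<open>x = h 0\<close> by (auto simp: B_def)
      then obtain \<alpha> \<beta> where \<alpha>: "\<alpha> \<noteq> 0" "v y = (\<lambda>k. \<alpha> * v x k + \<beta> * v t k)"
        using line[OF x(1) _ x(2)] by blast
      define c where "c u = (if u = y then - 1 else \<alpha> * \<delta> u + (if u = t then \<beta> else 0))" for u
      have "(\<Sum>u\<in>insert y B. c u * v u k) = 0" for k
      proof -
        have "(\<Sum>u\<in>B. c u * v u k) =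
            (\<Sum>u\<in>B. \<alpha> * (\<delta> u * v u k) + (if u = t then \<beta> * v t k else 0))"
          by (rule sum.cong) (use y in \<open>auto simp: c_def algebra_simps\<close>)
        also have "\<dots> = \<alpha> * v x k + \<beta> * v t k"
          unfolding sum.distrib sum_distrib_left[symmetric] \<open>x = h 0\<close> first
          using B(3) by (simp add: \<open>t \<in> B\<close>)
        finally have *: "(\<Sum>u\<in>B. c u * v u k) = \<alpha> * v x k + \<beta> * v t k" .
        have "(\<Sum>u\<in>insert y B. c u * v u k) = c y * v y k + (\<Sum>u\<in>B. c u * v u k)"
          using y B(3) by simp
        then show ?thesis unfolding * \<alpha>(2) by (simp add: c_def)
      qed
      moreover have "indep_vecs v (insert y B)" using indep_v[of "insert y B"] ind y B(2) by auto
      ultimately have "c y = 0" using indep_vecsD[of v "insert y B" c y] by blast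
      then show False by (simp add: c_def)
    qed
  qed
  then have rank_S: "matroid_rank S = r" by (simp add: card_B)
  have "f ` ground S = {..<dim_col A}" using f by (simp add: bij_betw_def)
  then have r_eq: "r = real_rank A"
    using rank[OF subset_refl] rank_S by (simp add: submatrix_all)

  define x where "x j = v (h j)" for j
  define g where "g \<rho> i = rows_det r \<rho> (x(i := v t))" for \<rho> i
  have "\<exists>\<rho>. \<rho> ` {..<r} \<subseteq> {..<dim_row A} \<and> rows_det r \<rho> (x(0 := v t)) \<noteq> 0"
  proof (rule exists_nonzero_minor)
    fix c assume c: "\<forall>k\<in>{..<dim_row A}. (\<Sum>j<r. c j * (x(0 := v t)) j k) = 0"
    define h' where "h' j = (if j = 0 then t else h j)" for j
    have x_h': "x(0 := v t) = v \<circ> h'" by (auto simp: x_def h'_def)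
    have "inj_on h' {..<r}"
      using h_inj hT tT(1) by (auto simp: inj_on_def h'_def)
    moreover have "h' ` {..<r} = B"
    proof (rule card_subset_eq[OF B(3)])
      show "h' ` {..<r} \<subseteq> B" using hT h_inj r0 by (auto simp: h'_def B_def)
      show "card (h' ` {..<r}) = card B"
        using \<open>inj_on h' {..<r}\<close> by (simp add: card_image card_B)
    qed
    ultimately have "indep_vecs (v \<circ> h') {..<r}"
      using indep_vecs_image[of h' "{..<r}" v] indep_v[OF B(2)] B(1) by simp
    moreover have "(\<Sum>j<r. c j * (v \<circ> h') j k) = 0" for k
    proof (cases "k < dim_row A")
      case True
      then show ?thesis using c unfolding x_h' by simp
    qed (simp add: v_def col_fun_def)
    ultimately show "\<forall>j<r. c j = 0" using indep_vecsD[of "v \<circ> h'" "{..<r}" c] by blast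
  qed
  then obtain \<rho> where \<rho>: "\<rho> ` {..<r} \<subseteq> {..<dim_row A}" and g0: "g \<rho> 0 \<noteq> 0"
    by (auto simp: g_def)
  \<comment> \<open>The same rows serve every leg \<open>i\<close>. Expanding \<open>x 0\<close> over \<open>B\<close> leaves only its \<open>x i\<close>
    component, since all other vectors of \<open>B\<close> already occur; exchanging two rows then leads back
    to \<open>g \<rho> 0\<close>.\<close>
  have g_nz: "g \<rho> i \<noteq> 0" if i: "i < r" for i
  proof (cases "i = 0")
    case False
    let ?w = "x(i := v t)"
    have "?w = ?w(0 := (\<lambda>k. \<Sum>u\<in>B. \<delta> u * v u k))"
      using False first by (auto simp: x_def)
    then have "g \<rho> i = rows_det r \<rho> (?w(0 := (\<lambda>k. \<Sum>u\<in>B. \<delta> u * v u k)))"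
      unfolding g_def by (rule arg_cong)
    also have "\<dots> = (\<Sum>u\<in>B. \<delta> u * rows_det r \<rho> (?w(0 := v u)))"
      by (rule rows_det_sum[OF r0 B(3)])
    also have "\<dots> = (\<Sum>u\<in>{h i}. \<delta> u * rows_det r \<rho> (?w(0 := v u)))"
    proof (rule sum.mono_neutral_right[OF B(3)])
      show "{h i} \<subseteq> B" using hT[OF i] h_inj[OF i r0] False by (simp add: B_def)
      show "\<forall>u\<in>B - {h i}. \<delta> u * rows_det r \<rho> (?w(0 := v u)) = 0"
      proof
        fix u assume u: "u \<in> B - {h i}"
        have "rows_det r \<rho> (?w(0 := v u)) = 0"
        proof (cases "u = t")
          case True
          show ?thesis by (rule rows_det_equal_rows[OF r0 i]) (use False True in auto)
        next
          case ut: False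
          then have "u \<in> T - {h 0}" using u by (simp add: B_def)
          then obtain j where j: "j < r" "u = h j" "j \<noteq> 0" using h by (auto simp: bij_betw_def)
          then have "j \<noteq> i" using u by auto
          show ?thesis
            by (rule rows_det_equal_rows[OF r0 j(1)]) (use False j \<open>j \<noteq> i\<close> in \<open>auto simp: x_def\<close>)
        qed
        then show "\<delta> u * rows_det r \<rho> (?w(0 := v u)) = 0" by simp
      qed
    qed
    also have "\<dots> = \<delta> (h i) * rows_det r \<rho> (x(i := v t, 0 := x i))"
      by (simp add: x_def)
    also have "rows_det r \<rho> (x(i := v t, 0 := x i)) = - rows_det r \<rho> (x(i := x i, 0 := v t))"
      by (rule rows_det_swap[OF i r0 False])
    also have "x(i := x i, 0 := v t) = x(0 := v t)" unfolding fun_upd_triv ..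
    finally have "g \<rho> i = \<delta> (h i) * - g \<rho> 0" unfolding g_def .
    moreover have "\<delta> (h i) \<noteq> 0" using \<gamma>[OF hT[OF i]] \<gamma>[OF hT[OF r0]] by (simp add: \<delta>_def)
    ultimately show ?thesis using g0 by simp
  qed (use g0 in simp)

  have minor: "rows_det r \<rho> w \<in> \<int> \<and> \<bar>rows_det r \<rho> w\<bar> \<le> \<Delta>"
    if w: "\<And>j. j < r \<Longrightarrow> \<exists>u\<in>ground S. w j = v u" for w
  proof -
    obtain s where s: "\<And>j. j < r \<Longrightarrow> s j \<in> ground S \<and> w j = v (s j)" using w by metis
    have "rows_det r \<rho> w = rows_det r \<rho> (\<lambda>j. col_fun A ((f \<circ> s) j))"
      unfolding rows_det_def using s
      by (intro arg_cong[of _ _ det] eq_matI) (auto simp: v_def)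
    moreover have "(f \<circ> s) ` {..<r} \<subseteq> {..<dim_col A}"
      using s f by (auto simp: bij_betw_def)
    ultimately show ?thesis using abs_det_columns_le[OF A r_eq \<rho>, of "f \<circ> s"] by simp
  qed
  define flip where "flip Y j = (if j \<in> Y then (\<lambda>k. a (h j) * x j k + b (h j) * v t k) else x j)" for Y j
  have flip: "\<exists>u\<in>ground S. flip Y j = v u" if "j < r" for Y j
  proof -
    have "flip Y j = v (if j \<in> Y then p (h j) else h j)"
      using p[OF hT[OF that]] by (simp add: flip_def x_def)
    moreover have "(if j \<in> Y then p (h j) else h j) \<in> ground S"
      using p[OF hT[OF that]] hT[OF that] tT(2) by auto
    ultimately show ?thesis by blast
  qed

  have "card {..<r} \<le> 2 * \<Delta>"
  proof (rule card_le_of_bounded_flips[where a = "a \<circ> h" and g = "g \<rho>" and c = "rows_det r \<rho> x"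
        and e = "\<lambda>i. b (h i) * g \<rho> i / a (h i)"])
    fix i assume "i \<in> {..<r}"
    then have i: "i < r" by simp
    show "(a \<circ> h) i \<noteq> 0" "b (h i) * g \<rho> i / a (h i) \<noteq> 0" "g \<rho> i \<noteq> 0"
      using p[OF hT[OF i]] g_nz[OF i] by auto
  next
    fix Y assume Y: "Y \<subseteq> {..<r}"
    have "rows_det r \<rho> (flip Y) = prod (a \<circ> h) Y * (rows_det r \<rho> x + (\<Sum>i\<in>Y. b (h i) * g \<rho> i / a (h i)))"
      using rows_det_flip[of Y r "a \<circ> h" \<rho> x "b \<circ> h" "v t"] Y p hT finite_subset[OF Y]
      unfolding flip_def g_def comp_def by blast
    moreover have "rows_det r \<rho> (flip Y) \<in> \<int> \<and> \<bar>rows_det r \<rho> (flip Y)\<bar> \<le> \<Delta>"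
      by (rule minor) (rule flip)
    ultimately show "prod (a \<circ> h) Y * (rows_det r \<rho> x + (\<Sum>i\<in>Y. b (h i) * g \<rho> i / a (h i))) \<in> \<int>"
      "\<bar>prod (a \<circ> h) Y * (rows_det r \<rho> x + (\<Sum>i\<in>Y. b (h i) * g \<rho> i / a (h i)))\<bar> \<le> \<Delta>" by simp_all
  next
    fix i Y assume "i \<in> {..<r}" and Y: "Y \<subseteq> {..<r} - {i}"
    then have i: "i < r" by simp
    have "finite Y" using Y finite_subset by blast
    then have "rows_det r \<rho> ((flip Y)(i := v t)) = prod (a \<circ> h) Y * g \<rho> i"
      using rows_det_flip_with_tip[of Y r i \<rho> "a \<circ> h" x "b \<circ> h" "v t"] Y i
      unfolding flip_def g_def comp_def by blast
    moreover have "rows_det r \<rho> ((flip Y)(i := v t)) \<in> \<int> \<and> \<bar>rows_det r \<rho> ((flip Y)(i := v t))\<bar> \<le> \<Delta>"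
      by (rule minor) (use flip t in auto)
    ultimately show "g \<rho> i * prod (a \<circ> h) Y \<in> \<int>" "\<bar>g \<rho> i * prod (a \<circ> h) Y\<bar> \<le> \<Delta>"
      by (simp_all add: mult.commute)
  qed (use \<Delta> in auto)
  then show ?thesis using rank_S by simp
qed

theorem proposition2p1:
  fixes \<Delta> :: nat
  assumes "\<Delta> > 0"
  shows "\<not> (\<exists>S \<in> (modular_matroids \<Delta> :: 'a matroid set). spike S \<and> matroid_rank S > 2 * \<Delta>)"
  using spike_rank_le[OF _ _ _ _ assms] by (fastforce simp: modular_matroids_def spike_def)

end
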